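(* For each $t>0$, the operator $S_{-t}$ on $L^2(0,1)$ defined by $$(S_{-t}f)(x)=\frac{\phi_{-t}(x)}{x}f(\phi_{-t}(x)),\qquad \phi_{-t}(x)=\frac{e^{t}x}{(e^{t}-1)x+1},$$ is unitarily equivalent to $e^{\frac t2}B_t$, where $B_t$ is the backward bilateral shift on the vector-valued sequence space $\ell^2(\mathbb{Z},L^2[a_0,a_1])$ with $a_0=\frac12$ and $a_1=\frac{1}{1+e^{-t}}$.
   Context: $L^2(0,1)$ is the Hilbert space of complex-valued square-integrable functions on $(0,1)$ with respect to Lebesgue measure. $\ell^2(\mathbb{Z},L^2[a_0,a_1])$ is the Hilbert space of bilateral sequences $(g_n)_{n\in\mathbb{Z}}$ with each $g_n\in L^2[a_0,a_1]$ and $\sum_{n\in\mathbb{Z}}\|g_n\|^2_{L^2[a_0,a_1]}<\infty$. The backward bilateral shift is $B_t\big((g_n)_{n\in\mathbb{Z}}\big)=(g_{n+1})_{n\in\mathbb{Z}}$. Two bounded operators $T_1$ on $\mathcal H_1$ and $T_2$ on $\mathcal H_2$ are unitarily equivalent if there is a surjective linear isometry $V:\mathcal H_1\to\mathcal H_2$ with $VT_1=T_2V$. *)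

theory Defs
  imports "HOL-Analysis.Analysis"
begin

text \<open>
  The spaces below depend on real parameters (the interval \<open>[a\<^sub>0, a\<^sub>1]\<close> varies with \<open>t\<close>), so
  complex inner product spaces are represented by explicit carriers rather than by types.
  Values of the operations outside the carrier are irrelevant.
\<close>

record 'v ip_space =
  vcarrier :: "'v set"
  vadd :: "'v \<Rightarrow> 'v \<Rightarrow> 'v"
  vscale :: "complex \<Rightarrow> 'v \<Rightarrow> 'v"
  vinner :: "'v \<Rightarrow> 'v \<Rightarrow> complex"

definition vnorm :: "'v ip_space \<Rightarrow> 'v \<Rightarrow> real" where
  "vnorm H x = sqrt (Re (vinner H x x))"

definition linear_map :: "'v ip_space \<Rightarrow> 'w ip_space \<Rightarrow> ('v \<Rightarrow> 'w) \<Rightarrow> bool" where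
  "linear_map H K T \<longleftrightarrow>
     (\<forall>x\<in>vcarrier H. T x \<in> vcarrier K) \<and>
     (\<forall>x\<in>vcarrier H. \<forall>y\<in>vcarrier H. T (vadd H x y) = vadd K (T x) (T y)) \<and>
     (\<forall>c. \<forall>x\<in>vcarrier H. T (vscale H c x) = vscale K c (T x))"

definition bounded_operator :: "'v ip_space \<Rightarrow> ('v \<Rightarrow> 'v) \<Rightarrow> bool" where
  "bounded_operator H T \<longleftrightarrow>
     linear_map H H T \<and> (\<exists>C. \<forall>x\<in>vcarrier H. vnorm H (T x) \<le> C * vnorm H x)"

definition surj_linear_isometry :: "'v ip_space \<Rightarrow> 'w ip_space \<Rightarrow> ('v \<Rightarrow> 'w) \<Rightarrow> bool" where
  "surj_linear_isometry H K V \<longleftrightarrow>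
     linear_map H K V \<and> V ` vcarrier H = vcarrier K \<and>
     (\<forall>x\<in>vcarrier H. vnorm K (V x) = vnorm H x)"

text \<open>Unitary equivalence is a relation between bounded operators; boundedness is part of it.\<close>

definition unitarily_equivalent ::
    "'v ip_space \<Rightarrow> ('v \<Rightarrow> 'v) \<Rightarrow> 'w ip_space \<Rightarrow> ('w \<Rightarrow> 'w) \<Rightarrow> bool" where
  "unitarily_equivalent H\<^sub>1 T\<^sub>1 H\<^sub>2 T\<^sub>2 \<longleftrightarrow>
     bounded_operator H\<^sub>1 T\<^sub>1 \<and> bounded_operator H\<^sub>2 T\<^sub>2 \<and>
     (\<exists>V. surj_linear_isometry H\<^sub>1 H\<^sub>2 V \<and> (\<forall>x\<in>vcarrier H\<^sub>1. V (T\<^sub>1 x) = T\<^sub>2 (V x)))"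

definition square_integrable :: "'a measure \<Rightarrow> ('a \<Rightarrow> complex) set" where
  "square_integrable M = {f \<in> borel_measurable M. integrable M (\<lambda>x. (cmod (f x))\<^sup>2)}"

definition ae_rel :: "'a measure \<Rightarrow> (('a \<Rightarrow> complex) \<times> ('a \<Rightarrow> complex)) set" where
  "ae_rel M = {(f, g). f \<in> square_integrable M \<and> g \<in> square_integrable M \<and> (AE x in M. f x = g x)}"

text \<open>
  Elements of \<open>L\<^sup>2\<close> are genuine almost-everywhere classes. A map of functions is lifted to classes
  by taking the union, over all representatives, of the classes of the images; the union is a
  single class only if the image classes agree (the image of a function that is not square
  integrable has the empty class). The lemmas below show that the vector space operations and the
  inner product do not depend on representatives.
\<close>

definition L2 :: "'a measure \<Rightarrow> ('a \<Rightarrow> complex) set ip_space" where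
  "L2 M =
     \<lparr> vcarrier = square_integrable M // ae_rel M,
       vadd = (\<lambda>F G. \<Union>f\<in>F. \<Union>g\<in>G. ae_rel M `` {\<lambda>x. f x + g x}),
       vscale = (\<lambda>c F. \<Union>f\<in>F. ae_rel M `` {\<lambda>x. c * f x}),
       vinner = (\<lambda>F G. THE c. \<forall>f\<in>F. \<forall>g\<in>G. c = (\<integral>x. f x * cnj (g x) \<partial>M)) \<rparr>"

definition l2_int :: "'v ip_space \<Rightarrow> (int \<Rightarrow> 'v) ip_space" where
  "l2_int H =
     \<lparr> vcarrier = {g. (\<forall>n. g n \<in> vcarrier H) \<and> (\<lambda>n. (vnorm H (g n))\<^sup>2) summable_on UNIV},
       vadd = (\<lambda>g h n. vadd H (g n) (h n)),
       vscale = (\<lambda>c g n. vscale H c (g n)),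
       vinner = (\<lambda>g h. \<Sum>\<^sub>\<infinity>n. vinner H (g n) (h n)) \<rparr>"

definition backward_shift :: "(int \<Rightarrow> 'v) \<Rightarrow> (int \<Rightarrow> 'v)" where
  "backward_shift g = (\<lambda>n. g (n + 1))"

definition phi_neg :: "real \<Rightarrow> real \<Rightarrow> real" where
  "phi_neg t x = exp t * x / ((exp t - 1) * x + 1)"

text \<open>
  Since \<open>phi_neg t\<close> maps \<open>(0,1)\<close> into itself for \<open>t > 0\<close>, the values of a representative outside
  \<open>(0,1)\<close> play no role. That \<open>S_neg t F\<close> is an element of \<open>L\<^sup>2(0,1)\<close> is part of
  \<open>bounded_operator\<close>.
\<close>

definition S_neg :: "real \<Rightarrow> (real \<Rightarrow> complex) set \<Rightarrow> (real \<Rightarrow> complex) set" where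
  "S_neg t F =
     (\<Union>f\<in>F. ae_rel (lebesgue_on {0<..<1}) ``
       {\<lambda>x. complex_of_real (phi_neg t x / x) * f (phi_neg t x)})"

lemma equiv_ae_rel: "equiv (square_integrable M) (ae_rel M)"
proof (rule equivI)
  show "ae_rel M \<subseteq> square_integrable M \<times> square_integrable M"
    by (auto simp: ae_rel_def)
  show "refl_on (square_integrable M) (ae_rel M)"
    by (auto simp: refl_on_def ae_rel_def)
  show "sym (ae_rel M)"
    by (auto simp: sym_def ae_rel_def elim: eventually_mono)
  show "trans (ae_rel M)"
    by (auto simp: trans_def ae_rel_def elim: eventually_elim2)
qed

lemma square_integrable_add:
  assumes "f \<in> square_integrable M" "g \<in> square_integrable M"
  shows "(\<lambda>x. f x + g x) \<in> square_integrable M"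
proof -
  have [measurable]: "f \<in> borel_measurable M" "g \<in> borel_measurable M"
    using assms by (auto simp: square_integrable_def)
  have b: "(cmod (a + b))\<^sup>2 \<le> 2 * (cmod a)\<^sup>2 + 2 * (cmod b)\<^sup>2" for a b
  proof -
    have "(cmod (a + b))\<^sup>2 \<le> (cmod a + cmod b)\<^sup>2"
      by (intro power_mono norm_triangle_ineq) auto
    also have "\<dots> \<le> 2 * (cmod a)\<^sup>2 + 2 * (cmod b)\<^sup>2"
      using sum_squares_bound[of "cmod a" "cmod b"] by (simp add: power2_sum)
    finally show ?thesis .
  qed
  have "integrable M (\<lambda>x. 2 * (cmod (f x))\<^sup>2 + 2 * (cmod (g x))\<^sup>2)"
    using assms by (auto simp: square_integrable_def)
  then have "integrable M (\<lambda>x. (cmod (f x + g x))\<^sup>2)"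
    by (rule Bochner_Integration.integrable_bound) (auto simp: b)
  then show ?thesis
    by (simp add: square_integrable_def)
qed

lemma square_integrable_scale:
  assumes "f \<in> square_integrable M"
  shows "(\<lambda>x. c * f x) \<in> square_integrable M"
  using assms by (auto simp: square_integrable_def norm_mult power_mult_distrib)

lemma vadd_L2_class:
  assumes "f \<in> square_integrable M" "g \<in> square_integrable M"
  shows "vadd (L2 M) (ae_rel M `` {f}) (ae_rel M `` {g}) = ae_rel M `` {\<lambda>x. f x + g x}"
proof -
  have "congruent2 (ae_rel M) (ae_rel M) (\<lambda>f g. ae_rel M `` {\<lambda>x. f x + g x})"
  proof (rule congruent2I')
    fix f f' g g' assume *: "(f, f') \<in> ae_rel M" "(g, g') \<in> ae_rel M"
    then have "AE x in M. f x + g x = f' x + g' x"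
      by (auto simp: ae_rel_def elim: eventually_elim2)
    with * have "(\<lambda>x. f x + g x, \<lambda>x. f' x + g' x) \<in> ae_rel M"
      by (auto simp: ae_rel_def square_integrable_add)
    then show "ae_rel M `` {\<lambda>x. f x + g x} = ae_rel M `` {\<lambda>x. f' x + g' x}"
      by (rule equiv_class_eq[OF equiv_ae_rel])
  qed
  from UN_equiv_class2[OF equiv_ae_rel equiv_ae_rel this assms] show ?thesis
    by (simp add: L2_def)
qed

lemma vscale_L2_class:
  assumes "f \<in> square_integrable M"
  shows "vscale (L2 M) c (ae_rel M `` {f}) = ae_rel M `` {\<lambda>x. c * f x}"
proof -
  have "congruent (ae_rel M) (\<lambda>f. ae_rel M `` {\<lambda>x. c * f x})"
  proof (rule congruentI)
    fix f f' assume *: "(f, f') \<in> ae_rel M"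
    then have "AE x in M. c * f x = c * f' x"
      by (auto simp: ae_rel_def elim: eventually_mono)
    with * have "(\<lambda>x. c * f x, \<lambda>x. c * f' x) \<in> ae_rel M"
      by (simp add: ae_rel_def square_integrable_scale)
    then show "ae_rel M `` {\<lambda>x. c * f x} = ae_rel M `` {\<lambda>x. c * f' x}"
      by (rule equiv_class_eq[OF equiv_ae_rel])
  qed
  from UN_equiv_class[OF equiv_ae_rel this assms] show ?thesis
    by (simp add: L2_def)
qed

lemma vinner_L2_class:
  assumes "f \<in> square_integrable M" "g \<in> square_integrable M"
  shows "vinner (L2 M) (ae_rel M `` {f}) (ae_rel M `` {g}) = (\<integral>x. f x * cnj (g x) \<partial>M)"
proof -
  have eq: "(\<integral>x. f x * cnj (g x) \<partial>M) = (\<integral>x. f' x * cnj (g' x) \<partial>M)"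
    if "(f, f') \<in> ae_rel M" "(g, g') \<in> ae_rel M" for f' g'
  proof (rule integral_cong_AE)
    show "AE x in M. f x * cnj (g x) = f' x * cnj (g' x)"
      using that by (auto simp: ae_rel_def elim: eventually_elim2)
    have [measurable]: "f \<in> borel_measurable M" "g \<in> borel_measurable M"
        "f' \<in> borel_measurable M" "g' \<in> borel_measurable M"
      using that by (auto simp: ae_rel_def square_integrable_def)
    have [measurable]: "cnj \<in> borel_measurable borel"
      by (intro borel_measurable_continuous_onI continuous_intros)
    show "(\<lambda>x. f x * cnj (g x)) \<in> borel_measurable M" "(\<lambda>x. f' x * cnj (g' x)) \<in> borel_measurable M"
      by measurable
  qed
  have self: "(f, f) \<in> ae_rel M" "(g, g) \<in> ae_rel M"
    using assms by (auto simp: ae_rel_def)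
  have "(THE c. \<forall>f'\<in>ae_rel M `` {f}. \<forall>g'\<in>ae_rel M `` {g}. c = (\<integral>x. f' x * cnj (g' x) \<partial>M))
      = (\<integral>x. f x * cnj (g x) \<partial>M)"
  proof (rule the_equality)
    show "\<forall>f'\<in>ae_rel M `` {f}. \<forall>g'\<in>ae_rel M `` {g}.
        (\<integral>x. f x * cnj (g x) \<partial>M) = (\<integral>x. f' x * cnj (g' x) \<partial>M)"
      using eq by auto
  qed (use self in auto)
  then show ?thesis
    by (simp add: L2_def)
qed

end

theory Submission
  imports Defs
begin

text \<open>
  The maps \<open>phi_neg s\<close> form a flow on \<open>(0,1)\<close> which the logistic function conjugates to translations
  of the line (\<open>phi_neg_logistic\<close>). Since \<open>(phi_neg t x / x)\<^sup>2\<close> equals \<open>exp t\<close> times the derivative of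
  \<open>phi_neg t\<close> at \<open>x\<close> (\<open>phi_neg_weight\<close> and \<open>DERIV_phi_neg\<close>), the operator \<open>S_neg t\<close> is \<open>exp (t / 2)\<close>
  times the unitary \<open>U f = sqrt (phi_neg t)' \<cdot> (f \<circ> phi_neg t)\<close>, and the powers \<open>U\<^sup>n\<close> are the weighted
  compositions with \<open>phi_neg (n t)\<close>.

  The translation by \<open>t\<close> on the line has the fundamental interval \<open>[0, t]\<close>, which the logistic function
  maps onto \<open>[1/2, 1 / (1 + exp (- t))] = [a\<^sub>0, a\<^sub>1]\<close>. The images of this interval under the integer powers
  of \<open>phi_neg t\<close> tile \<open>(0,1)\<close> up to endpoints. A function on \<open>(0,1)\<close> is thus the same as the sequence of
  its restrictions to the tiles, and moving the \<open>n\<close>-th restriction back to \<open>[a\<^sub>0, a\<^sub>1]\<close> unitarily turns it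
  into the restriction of \<open>U\<^sup>n f\<close>. The map \<open>f \<mapsto> (U\<^sup>n f restricted to [a\<^sub>0, a\<^sub>1])\<^sub>n\<close> is the required unitary: it
  is isometric by the change of variables formula and countable additivity (\<open>has_sum_pull\<close>), it is
  surjective because square summable sequences can be glued
  (\<open>exists_square_integrable_with_pulls\<close>), and replacing \<open>f\<close> by \<open>U f\<close> shifts the sequence by one
  (\<open>orbit_map_S_neg\<close>).
\<close>

section \<open>The flow in logistic coordinates\<close>

definition logistic :: "real \<Rightarrow> real" where
  "logistic s = 1 / (1 + exp (- s))"

lemma logistic_less_iff: "logistic s < logistic s' \<longleftrightarrow> s < s'"
proof -
  have "1 + exp (- s) > 0" "1 + exp (- s') > 0" by (simp_all add: add_pos_pos)
  then show ?thesis by (simp add: logistic_def divide_simps)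
qed

lemma logistic_le_iff: "logistic s \<le> logistic s' \<longleftrightarrow> s \<le> s'"
  by (metis logistic_less_iff not_le)

lemma logistic_logit: "0 < x \<Longrightarrow> x < 1 \<Longrightarrow> logistic (ln (x / (1 - x))) = x"
  by (simp add: logistic_def exp_minus field_simps)

lemma range_logistic: "range logistic = {0<..<1}"
proof
  show "range logistic \<subseteq> {0<..<1}"
    by (auto simp: logistic_def divide_simps add_pos_pos)
  show "{0<..<1} \<subseteq> range logistic"
  proof
    fix x :: real assume "x \<in> {0<..<1}"
    then have "x = logistic (ln (x / (1 - x)))"
      by (simp add: logistic_logit)
    then show "x \<in> range logistic" by blast
  qed
qed

lemma unit_interval_cases:
  assumes "x \<in> {0<..<1}"
  obtains s where "x = logistic s"
  using assms unfolding range_logistic[symmetric] by auto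

lemma logistic_in: "logistic s \<in> {0<..<1}"
  using range_logistic by blast

text \<open>
  This identity explains the formula for \<open>phi_neg\<close>: in the coordinate \<open>s = ln (x / (1 - x))\<close> on
  \<open>(0,1)\<close> the map \<open>phi_neg r\<close> is the translation by \<open>r\<close>. The group law, bijectivity and the orbits of
  intervals are read off from this.
\<close>

lemma phi_neg_logistic: "phi_neg r (logistic s) = logistic (s + r)"
proof -
  have "1 + exp (- s) > 0" "1 + exp (- s - r) > 0" by (simp_all add: add_pos_pos)
  then have "1 + exp (- s) \<noteq> 0" "1 + exp (- s - r) \<noteq> 0" by linarith+
  have "(exp r - 1) / (1 + exp (- s)) + 1 = exp r * (1 + exp (- s - r)) / (1 + exp (- s))"
    using \<open>1 + exp (- s) \<noteq> 0\<close> by (simp add: field_simps flip: exp_add)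
  then show ?thesis
    using \<open>1 + exp (- s) \<noteq> 0\<close> by (simp add: phi_neg_def logistic_def)
qed

lemma phi_neg_in: "x \<in> {0<..<1} \<Longrightarrow> phi_neg s x \<in> {0<..<1}"
  by (erule unit_interval_cases) (metis phi_neg_logistic logistic_in)

lemma phi_neg_phi_neg: "x \<in> {0<..<1} \<Longrightarrow> phi_neg r (phi_neg s x) = phi_neg (s + r) x"
  by (erule unit_interval_cases) (simp add: phi_neg_logistic add.assoc)

lemma phi_neg_0 [simp]: "phi_neg 0 x = x"
  by (simp add: phi_neg_def)

lemma phi_neg_uminus:
  assumes "x \<in> {0<..<1}"
  shows "phi_neg (- s) (phi_neg s x) = x" "phi_neg s (phi_neg (- s) x) = x"
  using assms by (simp_all add: phi_neg_phi_neg)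

lemma inj_on_phi_neg: "inj_on (phi_neg s) {0<..<1}"
  by (rule inj_on_inverseI[of _ "phi_neg (- s)"]) (rule phi_neg_uminus(1))

lemma phi_neg_image_unit: "phi_neg s ` {0<..<1} = {0<..<1}"
proof
  show "phi_neg s ` {0<..<1} \<subseteq> {0<..<1}"
    using phi_neg_in by blast
  show "{0<..<1} \<subseteq> phi_neg s ` {0<..<1}"
    using phi_neg_in phi_neg_uminus(2)[symmetric] by (intro subsetI image_eqI)
qed

section \<open>Weighted composition with the flow\<close>

text \<open>
  The square root of the derivative of \<open>phi_neg s\<close>.
\<close>

definition weight :: "real \<Rightarrow> real \<Rightarrow> real" where
  "weight s x = exp (s / 2) / ((exp s - 1) * x + 1)"

lemma denominator_pos:
  assumes "x \<in> {0<..<1}" shows "(exp s - 1) * x + 1 > (0::real)"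
proof -
  have "(exp s - 1) * x + 1 = exp s * x + (1 - x)" by (simp add: algebra_simps)
  also have "\<dots> > 0" using assms by (intro add_pos_pos) simp_all
  finally show ?thesis .
qed

lemma weight_0 [simp]: "weight 0 x = 1"
  by (simp add: weight_def)

lemma DERIV_phi_neg:
  assumes "x \<in> {0<..<1}"
  shows "(phi_neg s has_field_derivative (weight s x)\<^sup>2) (at x within S)"
proof -
  have "(exp s - 1) * x + 1 \<noteq> 0" using denominator_pos[OF assms, of s] by simp
  moreover have "(exp (s / 2))\<^sup>2 = exp s" by (simp flip: exp_double)
  ultimately show ?thesis
    unfolding phi_neg_def
    by (auto intro!: derivative_eq_intros simp: weight_def power2_eq_square field_simps)
qed

lemma phi_neg_differentiable_on: "S \<subseteq> {0<..<1} \<Longrightarrow> phi_neg s differentiable_on S"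
  by (meson DERIV_phi_neg differentiable_on_def real_differentiable_def subsetD)

text \<open>
  The square root of the chain rule for \<open>phi_neg s \<circ> phi_neg r = phi_neg (r + s)\<close>.
\<close>

lemma weight_cocycle:
  assumes "x \<in> {0<..<1}"
  shows "weight r x * weight s (phi_neg r x) = weight (r + s) x"
proof -
  let ?D = "(exp r - 1) * x + 1"
  have D: "?D \<noteq> 0" using denominator_pos[OF assms, of r] by simp
  then have "(exp s - 1) * phi_neg r x + 1 = ((exp (r + s) - 1) * x + 1) / ?D"
    by (simp add: phi_neg_def exp_add divide_simps) (simp add: algebra_simps)
  then show ?thesis
    using D by (simp add: weight_def add_divide_distrib[of r s 2] exp_add)
qed

text \<open>
  The factor in the definition of \<open>S_neg t\<close> is therefore the unitary weight times the constant
  \<open>exp (t / 2)\<close>, which is where the scalar in front of the shift comes from.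
\<close>

lemma phi_neg_weight:
  assumes "x \<in> {0<..<1}"
  shows "phi_neg t x / x = exp (t / 2) * weight t x"
  using assms by (simp add: phi_neg_def weight_def flip: exp_add)

lemma continuous_on_weight: "S \<subseteq> {0<..<1} \<Longrightarrow> continuous_on S (weight s)"
  unfolding weight_def
  by (intro continuous_intros ballI less_imp_neq[THEN not_sym] denominator_pos) auto

text \<open>
  Composition with the flow, normalised by the square root of the Jacobian so as to preserve \<open>L\<^sup>2\<close>
  norms. It is applied both to functions on \<open>(0,1)\<close> and to functions on its subintervals.
\<close>

definition pull :: "real \<Rightarrow> (real \<Rightarrow> complex) \<Rightarrow> real \<Rightarrow> complex" where
  "pull s f x = of_real (weight s x) * f (phi_neg s x)"

lemma pull_pull: "x \<in> {0<..<1} \<Longrightarrow> pull r (pull s f) x = pull (r + s) f x"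
  by (simp add: pull_def phi_neg_phi_neg weight_cocycle[symmetric] del: greaterThanLessThan_iff)

lemma phi_neg_image_sets:
  assumes "S \<in> sets lebesgue" "S \<subseteq> {0<..<1}"
  shows "phi_neg s ` S \<in> sets lebesgue"
  using assms by (intro differentiable_image_in_sets_lebesgue phi_neg_differentiable_on) auto

text \<open>
  The inverse of the flow map is differentiable and so carries null sets to null sets.
\<close>

lemma AE_phi_neg:
  assumes S: "S \<in> sets lebesgue" "S \<subseteq> {0<..<1}"
    and AE: "AE y in lebesgue_on (phi_neg s ` S). P y"
  shows "AE x in lebesgue_on S. P (phi_neg s x)"
proof -
  let ?N = "{y \<in> phi_neg s ` S. \<not> P y}"
  have "AE y in lebesgue. y \<in> phi_neg s ` S \<longrightarrow> P y"
    using AE phi_neg_image_sets[OF S] by (simp add: AE_restrict_space_iff)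
  then obtain N where "N \<in> null_sets lebesgue" "{y \<in> space lebesgue. \<not> (y \<in> phi_neg s ` S \<longrightarrow> P y)} \<subseteq> N"
    unfolding eventually_ae_filter by blast
  then have "negligible N" "?N \<subseteq> N"
    by (auto simp: negligible_iff_null_sets)
  then have "negligible ?N"
    by (rule negligible_subset)
  moreover have "phi_neg (- s) differentiable_on ?N"
    using S phi_neg_in by (intro phi_neg_differentiable_on) blast
  ultimately have "negligible (phi_neg (- s) ` ?N)"
    by (simp add: negligible_differentiable_image_negligible)
  moreover have "{x \<in> S. \<not> P (phi_neg s x)} \<subseteq> phi_neg (- s) ` ?N"
  proof
    fix x assume x: "x \<in> {x \<in> S. \<not> P (phi_neg s x)}"
    then have "x = phi_neg (- s) (phi_neg s x)"
      using S by (intro phi_neg_uminus(1)[symmetric]) blast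
    then show "x \<in> phi_neg (- s) ` ?N"
      using x by blast
  qed
  ultimately have "negligible {x \<in> S. \<not> P (phi_neg s x)}"
    by (rule negligible_subset)
  then have "AE x in lebesgue. x \<notin> {x \<in> S. \<not> P (phi_neg s x)}"
    unfolding negligible_iff_null_sets by (rule AE_not_in)
  then show ?thesis
    using S by (simp add: AE_restrict_space_iff)
qed

text \<open>
  Continuity alone does not give measurability between Lebesgue \<open>\<sigma>\<close>-algebras. Here preimages are
  images under the differentiable inverse, and differentiable images of Lebesgue sets on the line are
  Lebesgue sets.
\<close>

lemma measurable_phi_neg:
  assumes S: "S \<in> sets lebesgue" "S \<subseteq> {0<..<1}"
  shows "phi_neg s \<in> lebesgue_on S \<rightarrow>\<^sub>M lebesgue_on (phi_neg s ` S)"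
proof (rule measurableI)
  fix A assume "A \<in> sets (lebesgue_on (phi_neg s ` S))"
  have T: "phi_neg s ` S \<in> sets lebesgue"
    using S by (rule phi_neg_image_sets)
  then have A: "A \<in> sets lebesgue" "A \<subseteq> phi_neg s ` S"
    using \<open>A \<in> sets (lebesgue_on (phi_neg s ` S))\<close> by (auto simp: sets_restrict_space_iff)
  have "phi_neg (- s) differentiable_on A"
    using A S phi_neg_in by (intro phi_neg_differentiable_on) blast
  then have "phi_neg (- s) ` A \<in> sets lebesgue"
    using A by (auto intro: differentiable_image_in_sets_lebesgue)
  moreover have "phi_neg s -` A \<inter> S = phi_neg (- s) ` A"
  proof (intro set_eqI iffI)
    fix x assume x: "x \<in> phi_neg s -` A \<inter> S"
    then have "x = phi_neg (- s) (phi_neg s x)"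
      using S by (intro phi_neg_uminus(1)[symmetric]) blast
    then show "x \<in> phi_neg (- s) ` A"
      using x by blast
  next
    fix x assume "x \<in> phi_neg (- s) ` A"
    then obtain z where z: "z \<in> S" "phi_neg s z \<in> A" "x = phi_neg (- s) (phi_neg s z)"
      using A by blast
    then have "x = z"
      using S phi_neg_uminus(1) by (metis subsetD)
    then show "x \<in> phi_neg s -` A \<inter> S"
      using z by simp
  qed
  ultimately show "phi_neg s -` A \<inter> space (lebesgue_on S) \<in> sets (lebesgue_on S)"
    using S A by (auto simp: sets_restrict_space_iff)
qed simp

text \<open>
  The change of variables formula, with \<open>(weight s)\<^sup>2\<close> as Jacobian.
\<close>

lemma pull_square_integrable:
  assumes S: "S \<in> sets lebesgue" "S \<subseteq> {0<..<1}"
    and f: "f \<in> square_integrable (lebesgue_on (phi_neg s ` S))"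
  shows "pull s f \<in> square_integrable (lebesgue_on S)"
    and "(\<integral>x. (cmod (pull s f x))\<^sup>2 \<partial>lebesgue_on S) = (\<integral>x. (cmod (f x))\<^sup>2 \<partial>lebesgue_on (phi_neg s ` S))"
proof -
  let ?T = "phi_neg s ` S"
  let ?h = "\<lambda>y. (cmod (f y))\<^sup>2"
  have T: "?T \<in> sets lebesgue"
    using S by (rule phi_neg_image_sets)
  have [measurable]: "f \<in> borel_measurable (lebesgue_on ?T)" and h: "integrable (lebesgue_on ?T) ?h"
    using f by (auto simp: square_integrable_def)
  have [measurable]: "(\<lambda>x. f (phi_neg s x)) \<in> borel_measurable (lebesgue_on S)"
    by (rule measurable_compose[OF measurable_phi_neg[OF S]]) measurable
  have [measurable]: "weight s \<in> borel_measurable (lebesgue_on S)"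
    using S continuous_on_weight by (intro continuous_imp_measurable_on_sets_lebesgue) auto
  have meas: "pull s f \<in> borel_measurable (lebesgue_on S)"
    unfolding pull_def[abs_def] by measurable
  have eq: "\<bar>(weight s x)\<^sup>2\<bar> * ?h (phi_neg s x) = (cmod (pull s f x))\<^sup>2" for x
    by (simp add: pull_def norm_mult power_mult_distrib)
  have ac: "g absolutely_integrable_on A \<longleftrightarrow> integrable (lebesgue_on A) g"
    if "A \<in> sets lebesgue" for A and g :: "real \<Rightarrow> real"
    using that by (simp add: set_integrable_def integrable_restrict_space)
  have "?h absolutely_integrable_on ?T \<and> integral ?T ?h = integral ?T ?h"
    using h T by (simp add: ac)
  then have "(\<lambda>x. \<bar>(weight s x)\<^sup>2\<bar> * ?h (phi_neg s x)) absolutely_integrable_on S \<and>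
      integral S (\<lambda>x. \<bar>(weight s x)\<^sup>2\<bar> * ?h (phi_neg s x)) = integral ?T ?h"
    using S DERIV_phi_neg inj_on_subset[OF inj_on_phi_neg]
    by (subst has_absolute_integral_change_of_variables_1') auto
  then have *: "integrable (lebesgue_on S) (\<lambda>x. (cmod (pull s f x))\<^sup>2)"
      "integral S (\<lambda>x. (cmod (pull s f x))\<^sup>2) = integral ?T ?h"
    using S unfolding eq by (simp_all add: ac)
  show "pull s f \<in> square_integrable (lebesgue_on S)"
    using meas * by (simp add: square_integrable_def)
  show "(\<integral>x. (cmod (pull s f x))\<^sup>2 \<partial>lebesgue_on S) = (\<integral>x. ?h x \<partial>lebesgue_on ?T)"
    using * h S T by (simp add: lebesgue_integral_eq_integral)
qed

section \<open>Square-integrable functions and their classes\<close>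

abbreviation L2_class :: "'a measure \<Rightarrow> ('a \<Rightarrow> complex) \<Rightarrow> ('a \<Rightarrow> complex) set" where
  "L2_class M f \<equiv> ae_rel M `` {f}"

lemma square_integrable_cong:
  "(\<And>x. x \<in> space M \<Longrightarrow> f x = g x) \<Longrightarrow> f \<in> square_integrable M \<longleftrightarrow> g \<in> square_integrable M"
  unfolding square_integrable_def
  by (simp cong: measurable_cong Bochner_Integration.integrable_cong)

lemma L2_class_cong:
  assumes "\<And>x. x \<in> space M \<Longrightarrow> f x = g x"
  shows "L2_class M f = L2_class M g"
proof -
  have "f \<in> square_integrable M \<longleftrightarrow> g \<in> square_integrable M"
    by (rule square_integrable_cong) (rule assms)
  moreover have "(AE x in M. f x = k x) \<longleftrightarrow> (AE x in M. g x = k x)" for k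
    by (intro AE_cong) (simp add: assms)
  ultimately show ?thesis
    by (auto simp: ae_rel_def)
qed

lemma L2_class_eq_AE: "(f, g) \<in> ae_rel M \<Longrightarrow> L2_class M f = L2_class M g"
  by (rule equiv_class_eq[OF equiv_ae_rel])

lemma L2_class_in_carrier: "f \<in> square_integrable M \<Longrightarrow> L2_class M f \<in> vcarrier (L2 M)"
  by (simp add: L2_def quotientI)

lemma L2_carrierE:
  assumes "F \<in> vcarrier (L2 M)"
  obtains f where "f \<in> square_integrable M" "F = L2_class M f"
  using assms by (auto simp: L2_def elim: quotientE)

lemma vinner_L2_class_self:
  assumes "f \<in> square_integrable M"
  shows "vinner (L2 M) (L2_class M f) (L2_class M f) = complex_of_real (\<integral>x. (cmod (f x))\<^sup>2 \<partial>M)"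
proof -
  have "(\<integral>x. f x * cnj (f x) \<partial>M) = (\<integral>x. complex_of_real ((cmod (f x))\<^sup>2) \<partial>M)"
    by (simp only: complex_norm_square)
  also have "\<dots> = complex_of_real (\<integral>x. (cmod (f x))\<^sup>2 \<partial>M)"
    by (rule integral_complex_of_real)
  finally show ?thesis
    using assms by (simp add: vinner_L2_class)
qed

lemma vnorm_L2_class:
  assumes "f \<in> square_integrable M"
  shows "(vnorm (L2 M) (L2_class M f))\<^sup>2 = (\<integral>x. (cmod (f x))\<^sup>2 \<partial>M)"
  using assms by (simp add: vnorm_def vinner_L2_class_self)

lemma vinner_L2_self:
  assumes "F \<in> vcarrier (L2 M)"
  shows "vinner (L2 M) F F = complex_of_real ((vnorm (L2 M) F)\<^sup>2)"
  using assms by (rule L2_carrierE) (simp add: vinner_L2_class_self vnorm_L2_class)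

lemma vnorm_L2_nonneg: "F \<in> vcarrier (L2 M) \<Longrightarrow> 0 \<le> vnorm (L2 M) F"
  by (elim L2_carrierE) (simp add: vnorm_def vinner_L2_class_self)

lemma vnorm_vscale_L2:
  assumes "F \<in> vcarrier (L2 M)"
  shows "(vnorm (L2 M) (vscale (L2 M) c F))\<^sup>2 = (cmod c)\<^sup>2 * (vnorm (L2 M) F)\<^sup>2"
proof -
  obtain f where f: "f \<in> square_integrable M" "F = L2_class M f"
    using assms by (rule L2_carrierE)
  then show ?thesis
    by (simp add: vscale_L2_class vnorm_L2_class square_integrable_scale norm_mult power_mult_distrib)
qed

lemma vscale_L2_in_carrier:
  "F \<in> vcarrier (L2 M) \<Longrightarrow> vscale (L2 M) c F \<in> vcarrier (L2 M)"
  by (auto elim!: L2_carrierE simp: vscale_L2_class square_integrable_scale intro!: L2_class_in_carrier)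

lemma vscale_vadd_L2:
  assumes "F \<in> vcarrier (L2 M)" "G \<in> vcarrier (L2 M)"
  shows "vscale (L2 M) c (vadd (L2 M) F G) = vadd (L2 M) (vscale (L2 M) c F) (vscale (L2 M) c G)"
proof -
  obtain f where f: "f \<in> square_integrable M" "F = L2_class M f"
    using assms(1) by (rule L2_carrierE)
  obtain g where g: "g \<in> square_integrable M" "G = L2_class M g"
    using assms(2) by (rule L2_carrierE)
  show ?thesis
    using f g by (simp add: vscale_L2_class vadd_L2_class square_integrable_add square_integrable_scale
        distrib_left)
qed

lemma vscale_vscale_L2:
  assumes "F \<in> vcarrier (L2 M)"
  shows "vscale (L2 M) c (vscale (L2 M) d F) = vscale (L2 M) d (vscale (L2 M) c F)"
proof -
  obtain f where f: "f \<in> square_integrable M" "F = L2_class M f"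
    using assms by (rule L2_carrierE)
  then show ?thesis
    by (simp add: vscale_L2_class square_integrable_scale mult.left_commute)
qed

text \<open>
  For elements of the carrier the complex series in the inner product is a convergent series of
  nonnegative reals, so the norm has its usual meaning.
\<close>

lemma
  assumes "g \<in> vcarrier (l2_int (L2 M))"
  shows vnorm_l2_int_L2: "(vnorm (l2_int (L2 M)) g)\<^sup>2 = (\<Sum>\<^sub>\<infinity>n. (vnorm (L2 M) (g n))\<^sup>2)"
    and vnorm_l2_int_L2_nonneg: "0 \<le> vnorm (l2_int (L2 M)) g"
proof -
  let ?c = "\<lambda>n. (vnorm (L2 M) (g n))\<^sup>2"
  have g: "g n \<in> vcarrier (L2 M)" "?c summable_on UNIV" for n
    using assms by (auto simp: l2_int_def)
  then have "((\<lambda>n. complex_of_real (?c n)) has_sum of_real (infsum ?c UNIV)) UNIV"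
    by (intro has_sum_of_real has_sum_infsum)
  then have "vinner (l2_int (L2 M)) g g = of_real (infsum ?c UNIV)"
    using g by (simp add: l2_int_def vinner_L2_self infsumI)
  then show "(vnorm (l2_int (L2 M)) g)\<^sup>2 = infsum ?c UNIV" "0 \<le> vnorm (l2_int (L2 M)) g"
    by (simp_all add: vnorm_def infsum_nonneg)
qed

text \<open>
  Reindexing the sum by \<open>n \<mapsto> n + 1\<close> shows that the shift preserves norms.
\<close>

lemma bounded_operator_scaled_shift:
  "bounded_operator (l2_int (L2 M)) (\<lambda>g. vscale (l2_int (L2 M)) c (backward_shift g))"
proof -
  let ?H = "l2_int (L2 M)"
  let ?T = "\<lambda>g. vscale ?H c (backward_shift g)"
  have bij: "bij_betw (\<lambda>n::int. n + 1) UNIV UNIV"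
    by (rule bij_betwI[of _ _ _ "\<lambda>n. n - 1"]) auto
  have T: "?T g \<in> vcarrier ?H \<and> vnorm ?H (?T g) = cmod c * vnorm ?H g" if "g \<in> vcarrier ?H" for g
  proof -
    have g: "g n \<in> vcarrier (L2 M)" "(\<lambda>n. (vnorm (L2 M) (g n))\<^sup>2) summable_on UNIV" for n
      using that by (auto simp: l2_int_def)
    have eq: "(vnorm (L2 M) (?T g n))\<^sup>2 = (cmod c)\<^sup>2 * (vnorm (L2 M) (g (n + 1)))\<^sup>2" for n
      by (simp add: l2_int_def backward_shift_def vnorm_vscale_L2 g)
    have "(\<lambda>n. (vnorm (L2 M) (g (n + 1)))\<^sup>2) summable_on UNIV"
      using summable_on_reindex_bij_betw[OF bij, of "\<lambda>n. (vnorm (L2 M) (g n))\<^sup>2"] g(2) by simp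
    then have "(\<lambda>n. (vnorm (L2 M) (?T g n))\<^sup>2) summable_on UNIV"
      unfolding eq by (rule summable_on_cmult_right)
    then have in_H: "?T g \<in> vcarrier ?H"
      using g by (simp add: l2_int_def backward_shift_def vscale_L2_in_carrier)
    have "(vnorm ?H (?T g))\<^sup>2 = (cmod c)\<^sup>2 * (\<Sum>\<^sub>\<infinity>n. (vnorm (L2 M) (g (n + 1)))\<^sup>2)"
      unfolding vnorm_l2_int_L2[OF in_H] eq by (rule infsum_cmult_right')
    also have "\<dots> = (cmod c * vnorm ?H g)\<^sup>2"
      using infsum_reindex_bij_betw[OF bij, of "\<lambda>n. (vnorm (L2 M) (g n))\<^sup>2"]
      by (simp add: vnorm_l2_int_L2[OF that] power_mult_distrib)
    finally show ?thesis
      using in_H that by (simp add: power2_eq_iff_nonneg vnorm_l2_int_L2_nonneg)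
  qed
  have "linear_map ?H ?H ?T"
    unfolding linear_map_def
    using T by (auto simp: l2_int_def backward_shift_def vscale_vadd_L2 vscale_vscale_L2)
  then show ?thesis
    unfolding bounded_operator_def using T by (auto intro!: exI[of _ "cmod c"])
qed

section \<open>Integration over a countable partition\<close>

text \<open>
  Almost everywhere \<open>h\<close> is the sum over \<open>i\<close> of its restrictions to the \<open>A i\<close>, so Tonelli's theorem for
  the product with the counting measure gives both directions. Requiring unique membership only almost
  everywhere allows closed intervals with common endpoints.
\<close>

lemma
  fixes h :: "'a \<Rightarrow> real" and A :: "'i::countable \<Rightarrow> 'a set"
  assumes A [measurable]: "\<And>i. A i \<in> sets M" and h [measurable]: "h \<in> borel_measurable M"
    and nonneg: "\<And>x. 0 \<le> h x" and partition: "AE x in M. \<exists>!i. x \<in> A i"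
  shows has_sum_integral_AE_partition:
      "integrable M h \<Longrightarrow> ((\<lambda>i. \<integral>x. h x \<partial>restrict_space M (A i)) has_sum (\<integral>x. h x \<partial>M)) UNIV"
    and integrable_AE_partition:
      "\<lbrakk>\<And>i. integrable (restrict_space M (A i)) h;
        (\<lambda>i. \<integral>x. h x \<partial>restrict_space M (A i)) summable_on UNIV\<rbrakk> \<Longrightarrow> integrable M h"
proof -
  let ?c = "\<lambda>i. \<integral>x. h x \<partial>restrict_space M (A i)"
  have c_nonneg: "?c i \<ge> 0" for i
    by (simp add: nonneg)
  have "(\<integral>\<^sup>+x. h x \<partial>M) = (\<integral>\<^sup>+x. \<integral>\<^sup>+i. ennreal (h x) * indicator (A i) x \<partial>count_space UNIV \<partial>M)"
  proof (rule nn_integral_cong_AE)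
    show "AE x in M. ennreal (h x) = (\<integral>\<^sup>+i. ennreal (h x) * indicator (A i) x \<partial>count_space UNIV)"
      using partition
    proof eventually_elim
      case (elim x)
      then obtain k where k: "\<And>i. x \<in> A i \<longleftrightarrow> i = k" by auto
      have "(\<integral>\<^sup>+i. ennreal (h x) * indicator (A i) x \<partial>count_space UNIV)
          = (\<integral>\<^sup>+i. ennreal (h x) * indicator {k} i \<partial>count_space UNIV)"
        by (intro nn_integral_cong) (auto simp: k indicator_def)
      also have "\<dots> = ennreal (h x)"
        by (subst nn_integral_cmult_indicator) auto
      finally show ?case by simp
    qed
  qed
  also have "\<dots> = (\<integral>\<^sup>+i. \<integral>\<^sup>+x. ennreal (h x) * indicator (A i) x \<partial>M \<partial>count_space UNIV)"
    by (rule nn_integral_count_space_nn_integral) auto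
  also have "\<dots> = (\<integral>\<^sup>+i. \<integral>\<^sup>+x. h x \<partial>restrict_space M (A i) \<partial>count_space UNIV)"
    by (intro nn_integral_cong) (simp add: nn_integral_restrict_space)
  finally have tonelli: "(\<integral>\<^sup>+x. h x \<partial>M) = (\<integral>\<^sup>+i. \<integral>\<^sup>+x. h x \<partial>restrict_space M (A i) \<partial>count_space UNIV)" .
  have sum: "(\<integral>\<^sup>+x. h x \<partial>M) = (\<integral>\<^sup>+i. ennreal (?c i) \<partial>count_space UNIV)"
    if "\<And>i. integrable (restrict_space M (A i)) h"
    unfolding tonelli by (intro nn_integral_cong nn_integral_eq_integral that) (simp add: nonneg)
  {
    assume int: "integrable M h"
    then have "integrable (restrict_space M (A i)) h" for i
      using integrable_mult_indicator[OF A int, of i] by (simp add: integrable_restrict_space)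
    then have eq: "(\<integral>\<^sup>+i. ennreal (?c i) \<partial>count_space UNIV) = ennreal (\<integral>x. h x \<partial>M)"
      using sum int nonneg by (simp add: nn_integral_eq_integral)
    then have c: "Infinite_Set_Sum.abs_summable_on ?c UNIV"
      using c_nonneg by (simp add: abs_summable_on_def integrable_iff_bounded)
    then have "infsum ?c UNIV = infsetsum ?c UNIV"
      by (rule infsetsum_infsum[symmetric])
    also have "\<dots> = (\<integral>x. h x \<partial>M)"
      unfolding infsetsum_def using eq c_nonneg nonneg by (intro integral_eq_nn_integral[THEN trans]) auto
    finally have "infsum ?c UNIV = (\<integral>x. h x \<partial>M)" .
    moreover have "?c summable_on UNIV"
      using c abs_summable_equivalent abs_summable_summable by blast
    ultimately show "(?c has_sum (\<integral>x. h x \<partial>M)) UNIV"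
      by (metis has_sum_infsum)
  }
  {
    assume int: "\<And>i. integrable (restrict_space M (A i)) h" and "?c summable_on UNIV"
    then have "Infinite_Set_Sum.abs_summable_on ?c UNIV"
      using c_nonneg by (simp flip: abs_summable_equivalent)
    then have "(\<integral>\<^sup>+x. h x \<partial>M) < \<infinity>"
      using c_nonneg by (simp add: sum[OF int] abs_summable_on_def integrable_iff_bounded)
    then show "integrable M h"
      using nonneg by (simp add: integrable_iff_bounded)
  }
qed

section \<open>The orbit of the fundamental interval\<close>

text \<open>
  The sets \<open>piece t n\<close> are the translates of \<open>piece t 0 = [a\<^sub>0, a\<^sub>1]\<close> under the integer powers of
  \<open>phi_neg t\<close>; in logistic coordinates they are the intervals \<open>[n t, (n + 1) t]\<close>.
\<close>

definition piece :: "real \<Rightarrow> int \<Rightarrow> real set" where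
  "piece t n = {logistic (of_int n * t) .. logistic ((of_int n + 1) * t)}"

lemma piece_0: "piece t 0 = {1/2 .. 1 / (1 + exp (- t))}"
  by (simp add: piece_def logistic_def)

lemma logistic_in_piece_iff:
  "logistic s \<in> piece t n \<longleftrightarrow> of_int n * t \<le> s \<and> s \<le> (of_int n + 1) * t"
  by (simp add: piece_def logistic_le_iff)

lemma piece_subset: "piece t n \<subseteq> {0<..<1}"
  using logistic_in unfolding piece_def
  by (metis atLeastAtMost_iff greaterThanLessThan_iff less_le_trans le_less_trans subsetI)

lemma piece_sets: "piece t n \<in> sets lebesgue"
  by (simp add: piece_def)

lemma phi_neg_image_piece: "phi_neg (of_int n * t) ` piece t 0 = piece t n"
proof (intro set_eqI iffI)
  fix y assume "y \<in> phi_neg (of_int n * t) ` piece t 0"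
  then obtain x where x: "x \<in> piece t 0" "y = phi_neg (of_int n * t) x" by blast
  then obtain s where "x = logistic s"
    using piece_subset by (meson subsetD unit_interval_cases)
  then show "y \<in> piece t n"
    using x by (simp add: phi_neg_logistic logistic_in_piece_iff algebra_simps)
next
  fix y assume y: "y \<in> piece t n"
  then obtain s where s: "y = logistic s"
    using piece_subset by (meson subsetD unit_interval_cases)
  then have "logistic (s - of_int n * t) \<in> piece t 0"
    using y by (simp add: logistic_in_piece_iff algebra_simps)
  moreover have "y = phi_neg (of_int n * t) (logistic (s - of_int n * t))"
    using s by (simp add: phi_neg_logistic)
  ultimately show "y \<in> phi_neg (of_int n * t) ` piece t 0" by blast
qed

lemma phi_neg_image_piece': "phi_neg (- (of_int n * t)) ` piece t n = piece t 0"
proof -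
  have "phi_neg (- (of_int n * t)) (phi_neg (of_int n * t) x) = x" if "x \<in> piece t 0" for x
    using that piece_subset phi_neg_uminus(1) by (metis subsetD)
  then show ?thesis
    unfolding phi_neg_image_piece[of n t, symmetric] image_image by simp
qed

lemma logistic_in_piece_unique:
  assumes "t > 0" "logistic s \<in> piece t n" "\<And>k. s \<noteq> of_int k * t"
  shows "n = \<lfloor>s / t\<rfloor>"
proof -
  have "s \<noteq> (of_int n + 1) * t"
    using assms(3)[of "n + 1"] by simp
  then have "of_int n \<le> s / t" "s / t < of_int n + 1"
    using assms(1,2) by (simp_all add: logistic_in_piece_iff pos_le_divide_eq pos_divide_less_eq)
  then show ?thesis
    by (simp add: floor_unique)
qed

lemma logistic_in_piece_floor:
  assumes "t > 0"
  shows "logistic s \<in> piece t \<lfloor>s / t\<rfloor>"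
proof -
  have "of_int \<lfloor>s / t\<rfloor> \<le> s / t" "s / t \<le> of_int \<lfloor>s / t\<rfloor> + 1"
    by linarith+
  then show ?thesis
    using assms unfolding pos_le_divide_eq[OF assms] pos_divide_le_eq[OF assms]
    by (simp add: logistic_in_piece_iff)
qed

lemma AE_not_endpoint:
  assumes "S \<in> sets lebesgue"
  shows "AE x in lebesgue_on S. \<forall>k::int. x \<noteq> logistic (of_int k * t)"
proof -
  have "range (\<lambda>k::int. logistic (of_int k * t)) \<in> null_sets lebesgue"
    by (intro null_sets_completionI countable_imp_null_set_lborel) simp
  then have "AE x in lebesgue. x \<notin> range (\<lambda>k::int. logistic (of_int k * t))"
    by (rule AE_not_in)
  then show ?thesis
    using assms by (auto simp: AE_restrict_space_iff elim: eventually_mono)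
qed

text \<open>
  In logistic coordinates this is the tiling of the line by intervals of length \<open>t\<close>; only the
  countably many endpoints are covered twice.
\<close>

lemma AE_ex1_piece:
  assumes "t > 0"
  shows "AE x in lebesgue_on {0<..<1}. \<exists>!n. x \<in> piece t n"
proof -
  have "AE x in lebesgue_on {0<..<1}. x \<in> {0<..<1::real}"
    by (intro AE_I2) simp
  moreover have "AE x in lebesgue_on {0<..<1}. \<forall>k::int. x \<noteq> logistic (of_int k * t)"
    by (rule AE_not_endpoint) simp
  ultimately show ?thesis
  proof eventually_elim
    case (elim x)
    then obtain s where s: "x = logistic s"
      by (meson unit_interval_cases)
    show ?case
    proof
      show "x \<in> piece t \<lfloor>s / t\<rfloor>"
        unfolding s by (rule logistic_in_piece_floor[OF assms])
      show "n = \<lfloor>s / t\<rfloor>" if "x \<in> piece t n" for n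
        using elim that s by (intro logistic_in_piece_unique[OF assms]) auto
    qed
  qed
qed

lemma restrict_lebesgue_on:
  assumes "S \<in> sets lebesgue" "A \<in> sets lebesgue" "A \<subseteq> S"
  shows "restrict_space (lebesgue_on S) A = lebesgue_on A"
  using assms by (simp add: restrict_restrict_space Int_absorb1)

lemma square_integrable_subset:
  assumes "f \<in> square_integrable (lebesgue_on S)" "S \<in> sets lebesgue" "A \<in> sets lebesgue" "A \<subseteq> S"
  shows "f \<in> square_integrable (lebesgue_on A)"
proof -
  have A: "A \<in> sets (lebesgue_on S)"
    using assms by (simp add: sets_restrict_space_iff)
  have "f \<in> borel_measurable (restrict_space (lebesgue_on S) A)"
    using assms by (auto simp: square_integrable_def intro: measurable_restrict_space1)
  moreover have "integrable (restrict_space (lebesgue_on S) A) (\<lambda>x. (cmod (f x))\<^sup>2)"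
    using integrable_mult_indicator[OF A, of "\<lambda>x. (cmod (f x))\<^sup>2"] assms(1) A
    by (subst integrable_restrict_space) (auto simp: square_integrable_def)
  ultimately show ?thesis
    using assms by (simp add: square_integrable_def restrict_lebesgue_on)
qed

lemma piece_in_sets: "piece t n \<in> sets (lebesgue_on {0<..<1})"
  using piece_sets piece_subset by (simp add: sets_restrict_space_iff del: greaterThanLessThan_iff)

lemma restrict_piece: "restrict_space (lebesgue_on {0<..<1}) (piece t n) = lebesgue_on (piece t n)"
  by (intro restrict_lebesgue_on piece_sets piece_subset) simp

lemma pull_piece:
  assumes "f \<in> square_integrable (lebesgue_on (piece t n))"
  shows "pull (of_int n * t) f \<in> square_integrable (lebesgue_on (piece t 0))"
    and "(\<integral>x. (cmod (pull (of_int n * t) f x))\<^sup>2 \<partial>lebesgue_on (piece t 0)) =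
      (\<integral>x. (cmod (f x))\<^sup>2 \<partial>lebesgue_on (piece t n))"
  using pull_square_integrable[OF piece_sets[of t 0] piece_subset, of f "of_int n * t"] assms
  by (simp_all add: phi_neg_image_piece)

lemma pull_piece':
  assumes "f \<in> square_integrable (lebesgue_on (piece t 0))"
  shows "pull (- (of_int n * t)) f \<in> square_integrable (lebesgue_on (piece t n))"
    and "(\<integral>x. (cmod (pull (- (of_int n * t)) f x))\<^sup>2 \<partial>lebesgue_on (piece t n)) =
      (\<integral>x. (cmod (f x))\<^sup>2 \<partial>lebesgue_on (piece t 0))"
  using pull_square_integrable[OF piece_sets[of t n] piece_subset, of f "- (of_int n * t)"] assms
  by (simp_all add: phi_neg_image_piece')

lemma square_integrable_piece:
  "f \<in> square_integrable (lebesgue_on {0<..<1}) \<Longrightarrow> f \<in> square_integrable (lebesgue_on (piece t n))"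
  by (erule square_integrable_subset) (simp_all add: piece_sets piece_subset)

text \<open>
  This is the isometry property of the orbit map on the level of functions: the energy of \<open>f\<close> on
  \<open>(0,1)\<close> is split over the pieces, and each piece is moved back to \<open>piece t 0\<close>.
\<close>

lemma has_sum_pull:
  assumes "t > 0" and f: "f \<in> square_integrable (lebesgue_on {0<..<1})"
  shows "((\<lambda>n. \<integral>x. (cmod (pull (of_int n * t) f x))\<^sup>2 \<partial>lebesgue_on (piece t 0)) has_sum
    (\<integral>x. (cmod (f x))\<^sup>2 \<partial>lebesgue_on {0<..<1})) UNIV"
proof -
  have "((\<lambda>n. \<integral>x. (cmod (f x))\<^sup>2 \<partial>restrict_space (lebesgue_on {0<..<1}) (piece t n)) has_sum
      (\<integral>x. (cmod (f x))\<^sup>2 \<partial>lebesgue_on {0<..<1})) UNIV"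
    using f AE_ex1_piece[OF assms(1)] piece_in_sets
    by (intro has_sum_integral_AE_partition) (auto simp: square_integrable_def)
  then show ?thesis
    by (simp add: restrict_piece pull_piece(2)[OF square_integrable_piece[OF f]])
qed

lemma pull_ae_rel:
  assumes S: "S \<in> sets lebesgue" "S \<subseteq> {0<..<1}"
    and "(f, g) \<in> ae_rel (lebesgue_on (phi_neg s ` S))"
  shows "(pull s f, pull s g) \<in> ae_rel (lebesgue_on S)"
proof -
  have fg: "f \<in> square_integrable (lebesgue_on (phi_neg s ` S))" "g \<in> square_integrable (lebesgue_on (phi_neg s ` S))"
    "AE y in lebesgue_on (phi_neg s ` S). f y = g y"
    using assms(3) by (auto simp: ae_rel_def)
  have "AE x in lebesgue_on S. f (phi_neg s x) = g (phi_neg s x)"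
    using S fg(3) by (rule AE_phi_neg)
  then have "AE x in lebesgue_on S. pull s f x = pull s g x"
    by (rule eventually_mono) (simp add: pull_def)
  then show ?thesis
    using pull_square_integrable(1)[OF S] fg by (simp add: ae_rel_def)
qed

lemma ae_rel_piece:
  assumes "(f, g) \<in> ae_rel (lebesgue_on {0<..<1})"
  shows "(f, g) \<in> ae_rel (lebesgue_on (piece t n))"
proof -
  have "AE x in restrict_space (lebesgue_on {0<..<1}) (piece t n). f x = g x"
    using assms piece_in_sets[of t n] piece_subset[of t n]
    by (subst AE_restrict_space_iff) (auto simp: ae_rel_def Int_absorb2 elim: eventually_mono)
  then have "AE x in lebesgue_on (piece t n). f x = g x"
    unfolding restrict_piece .
  then show ?thesis
    using assms square_integrable_piece by (auto simp: ae_rel_def)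
qed

text \<open>
  This is the surjectivity of the orbit map on the level of functions. The preimage is obtained by
  moving each \<open>g n\<close> forward from \<open>piece t 0\<close> to \<open>piece t n\<close> and gluing; the sum condition is exactly the
  square integrability of the glued function.
\<close>

lemma exists_square_integrable_with_pulls:
  assumes t: "t > 0" and g: "\<And>n. g n \<in> square_integrable (lebesgue_on (piece t 0))"
    and sum: "(\<lambda>n. \<integral>x. (cmod (g n x))\<^sup>2 \<partial>lebesgue_on (piece t 0)) summable_on UNIV"
  obtains f where "f \<in> square_integrable (lebesgue_on {0<..<1})"
    "\<And>n. L2_class (lebesgue_on (piece t 0)) (pull (of_int n * t) f) = L2_class (lebesgue_on (piece t 0)) (g n)"
proof -
  let ?I = "lebesgue_on {0<..<1}"
  let ?h = "\<lambda>n. pull (- (of_int n * t)) (g n)"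
  \<comment> \<open>The index of the piece that contains \<open>x\<close>, from the logistic coordinate of \<open>x\<close>. At an endpoint
    one of the two candidates is chosen; this affects a null set only.\<close>
  let ?idx = "\<lambda>x. \<lfloor>ln (x / (1 - x)) / t\<rfloor>"
  \<comment> \<open>The indicator is there for measurability: \<open>?h n\<close> is known to be measurable only on \<open>piece t n\<close>.\<close>
  define f where "f x = indicator (piece t (?idx x)) x *\<^sub>R ?h (?idx x) x" for x
  have h: "?h n \<in> square_integrable (lebesgue_on (piece t n))" for n
    by (rule pull_piece'(1)[OF g])
  have meas: "f \<in> borel_measurable ?I"
    unfolding f_def
  proof (rule measurable_compose_countable[where f = "\<lambda>n x. indicator (piece t n) x *\<^sub>R ?h n x"])
    fix n
    have "?h n \<in> borel_measurable (restrict_space ?I (piece t n))"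
      using h[of n] by (simp add: restrict_piece square_integrable_def)
    then show "(\<lambda>x. indicator (piece t n) x *\<^sub>R ?h n x) \<in> borel_measurable ?I"
      using piece_in_sets[of t n] by (subst (asm) borel_measurable_restrict_space_iff) auto
  next
    have "(\<lambda>x::real. ln (x / (1 - x)) / t) \<in> borel_measurable borel"
      by measurable
    then have "?idx \<in> borel \<rightarrow>\<^sub>M count_space UNIV"
      by measurable
    then show "?idx \<in> ?I \<rightarrow>\<^sub>M count_space UNIV"
      by (simp add: measurable_completion measurable_restrict_space1)
  qed
  have AE: "AE x in lebesgue_on (piece t n). f x = ?h n x" for n
  proof -
    have "AE x in lebesgue_on (piece t n). x \<in> piece t n"
      by (intro AE_I2) simp
    moreover have "AE x in lebesgue_on (piece t n). \<forall>k::int. x \<noteq> logistic (of_int k * t)"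
      by (rule AE_not_endpoint[OF piece_sets])
    ultimately show ?thesis
    proof eventually_elim
      case (elim x)
      then have x: "0 < x" "x < 1"
        using piece_subset[of t n] by auto
      have "logistic (ln (x / (1 - x))) = x"
        using x by (rule logistic_logit)
      then have "n = ?idx x"
        using elim by (intro logistic_in_piece_unique[OF t]) metis+
      then show "f x = ?h n x"
        using elim by (simp add: f_def)
    qed
  qed
  have "f \<in> borel_measurable (lebesgue_on (piece t n))" for n
    using measurable_restrict_space1[OF meas, of "piece t n"] by (simp add: restrict_piece)
  then have norm_meas: "(\<lambda>x. (cmod (f x))\<^sup>2) \<in> borel_measurable (lebesgue_on (piece t n))"
      and f_piece: "f \<in> borel_measurable (lebesgue_on (piece t n))" for n
    by measurable
  have norm_AE: "AE x in lebesgue_on (piece t n). (cmod (f x))\<^sup>2 = (cmod (?h n x))\<^sup>2" for n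
    using AE[of n] by eventually_elim simp
  have h_int: "integrable (lebesgue_on (piece t n)) (\<lambda>x. (cmod (?h n x))\<^sup>2)" for n
    using h[of n] by (simp add: square_integrable_def)
  have int: "integrable (lebesgue_on (piece t n)) (\<lambda>x. (cmod (f x))\<^sup>2)" for n
    using integrable_cong_AE[OF norm_meas borel_measurable_integrable[OF h_int] norm_AE] h_int by blast
  have int_eq: "(\<integral>x. (cmod (f x))\<^sup>2 \<partial>lebesgue_on (piece t n)) = (\<integral>x. (cmod (?h n x))\<^sup>2 \<partial>lebesgue_on (piece t n))" for n
    by (rule integral_cong_AE[OF norm_meas borel_measurable_integrable[OF h_int] norm_AE])
  have f_h: "(f, ?h n) \<in> ae_rel (lebesgue_on (piece t n))" for n
    using f_piece int h AE by (simp add: ae_rel_def square_integrable_def)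
  have "integrable ?I (\<lambda>x. (cmod (f x))\<^sup>2)"
  proof (rule integrable_AE_partition[OF piece_in_sets _ _ AE_ex1_piece[OF t]])
    show "integrable (restrict_space ?I (piece t n)) (\<lambda>x. (cmod (f x))\<^sup>2)" for n
      unfolding restrict_piece by (rule int)
    show "(\<lambda>n. \<integral>x. (cmod (f x))\<^sup>2 \<partial>restrict_space ?I (piece t n)) summable_on UNIV"
      unfolding restrict_piece int_eq pull_piece'(2)[OF g] by (rule sum)
  qed (use meas in measurable)
  then have f: "f \<in> square_integrable ?I"
    using meas by (simp add: square_integrable_def)
  show ?thesis
  proof (rule that[OF f])
    fix n
    have "(pull (of_int n * t) f, pull (of_int n * t) (?h n)) \<in> ae_rel (lebesgue_on (piece t 0))"
      by (rule pull_ae_rel[OF piece_sets piece_subset]) (use f_h[of n] in \<open>simp add: phi_neg_image_piece\<close>)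
    then have "L2_class (lebesgue_on (piece t 0)) (pull (of_int n * t) f) =
        L2_class (lebesgue_on (piece t 0)) (pull (of_int n * t) (?h n))"
      by (rule L2_class_eq_AE)
    also have "L2_class (lebesgue_on (piece t 0)) (pull (of_int n * t) (?h n)) =
        L2_class (lebesgue_on (piece t 0)) (g n)"
    proof (rule L2_class_cong)
      fix x assume "x \<in> space (lebesgue_on (piece t 0))"
      then show "pull (of_int n * t) (?h n) x = g n x"
        using piece_subset[of t 0] by (subst pull_pull) (auto simp: pull_def)
    qed
    finally show "L2_class (lebesgue_on (piece t 0)) (pull (of_int n * t) f) =
        L2_class (lebesgue_on (piece t 0)) (g n)" .
  qed
qed

section \<open>The unitary equivalence\<close>

lemma S_neg_class:
  assumes "f \<in> square_integrable (lebesgue_on {0<..<1})"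
  shows "(\<lambda>x. of_real (exp (t / 2)) * pull t f x) \<in> square_integrable (lebesgue_on {0<..<1})"
    and "S_neg t (L2_class (lebesgue_on {0<..<1}) f) =
      L2_class (lebesgue_on {0<..<1}) (\<lambda>x. of_real (exp (t / 2)) * pull t f x)"
proof -
  let ?I = "lebesgue_on {0<..<1::real}"
  let ?P = "\<lambda>f x. complex_of_real (exp (t / 2)) * pull t f x"
  show "?P f \<in> square_integrable ?I"
    using assms pull_square_integrable(1)[of "{0<..<1}" f t]
    by (simp add: phi_neg_image_unit square_integrable_scale)
  have S: "L2_class ?I (\<lambda>x. of_real (phi_neg t x / x) * g (phi_neg t x)) = L2_class ?I (?P g)" for g
    by (rule L2_class_cong) (simp add: pull_def phi_neg_weight del: greaterThanLessThan_iff)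
  have "congruent (ae_rel ?I) (\<lambda>g. L2_class ?I (?P g))"
  proof (rule congruentI)
    fix g h assume "(g, h) \<in> ae_rel ?I"
    then have "(pull t g, pull t h) \<in> ae_rel ?I"
      by (intro pull_ae_rel) (simp_all add: phi_neg_image_unit)
    then have "(?P g, ?P h) \<in> ae_rel ?I"
      by (auto simp: ae_rel_def square_integrable_scale elim: eventually_mono)
    then show "L2_class ?I (?P g) = L2_class ?I (?P h)"
      by (rule L2_class_eq_AE)
  qed
  from UN_equiv_class[OF equiv_ae_rel this assms]
  show "S_neg t (L2_class ?I f) = L2_class ?I (?P f)"
    unfolding S_neg_def S .
qed

text \<open>
  The intertwining unitary: \<open>f\<close> is sent to the restrictions to \<open>piece t 0\<close> of its images under the
  powers \<open>U\<^sup>n\<close> of the unitary part \<open>U = pull t\<close> of \<open>S_neg t\<close>. It acts on classes by the same union over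
  representatives as \<open>S_neg\<close>.
\<close>

definition orbit_map :: "real \<Rightarrow> (real \<Rightarrow> complex) set \<Rightarrow> int \<Rightarrow> (real \<Rightarrow> complex) set" where
  "orbit_map t F n = (\<Union>f\<in>F. L2_class (lebesgue_on (piece t 0)) (pull (of_int n * t) f))"

text \<open>
  Independence of the representative: functions that agree almost everywhere on \<open>piece t n\<close> have pulls
  that agree almost everywhere on \<open>piece t 0\<close>.
\<close>

lemma orbit_map_class:
  assumes "f \<in> square_integrable (lebesgue_on {0<..<1})"
  shows "orbit_map t (L2_class (lebesgue_on {0<..<1}) f) n =
    L2_class (lebesgue_on (piece t 0)) (pull (of_int n * t) f)"
proof -
  have "congruent (ae_rel (lebesgue_on {0<..<1}))
      (\<lambda>f. L2_class (lebesgue_on (piece t 0)) (pull (of_int n * t) f))"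
  proof (rule congruentI)
    fix g h assume "(g, h) \<in> ae_rel (lebesgue_on {0<..<1::real})"
    then have "(g, h) \<in> ae_rel (lebesgue_on (phi_neg (of_int n * t) ` piece t 0))"
      unfolding phi_neg_image_piece by (rule ae_rel_piece)
    then have "(pull (of_int n * t) g, pull (of_int n * t) h) \<in> ae_rel (lebesgue_on (piece t 0))"
      by (rule pull_ae_rel[OF piece_sets piece_subset])
    then show "L2_class (lebesgue_on (piece t 0)) (pull (of_int n * t) g) =
        L2_class (lebesgue_on (piece t 0)) (pull (of_int n * t) h)"
      by (rule L2_class_eq_AE)
  qed
  from UN_equiv_class[OF equiv_ae_rel this assms] show ?thesis
    unfolding orbit_map_def .
qed

lemma bounded_operator_S_neg: "bounded_operator (L2 (lebesgue_on {0<..<1})) (S_neg t)"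
proof -
  let ?I = "lebesgue_on {0<..<1::real}"
  have add: "S_neg t (vadd (L2 ?I) F G) = vadd (L2 ?I) (S_neg t F) (S_neg t G)"
    if F: "F \<in> vcarrier (L2 ?I)" and G: "G \<in> vcarrier (L2 ?I)" for F G
  proof -
    obtain f where "f \<in> square_integrable ?I" "F = L2_class ?I f"
      using F by (rule L2_carrierE)
    moreover obtain g where "g \<in> square_integrable ?I" "G = L2_class ?I g"
      using G by (rule L2_carrierE)
    ultimately show ?thesis
      by (simp add: S_neg_class vadd_L2_class square_integrable_add)
         (simp add: pull_def algebra_simps)
  qed
  have scale: "S_neg t (vscale (L2 ?I) c F) = vscale (L2 ?I) c (S_neg t F)"
    if F: "F \<in> vcarrier (L2 ?I)" for c F
  proof -
    obtain f where "f \<in> square_integrable ?I" "F = L2_class ?I f"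
      using F by (rule L2_carrierE)
    then show ?thesis
      by (simp add: S_neg_class vscale_L2_class square_integrable_scale)
         (simp add: pull_def algebra_simps)
  qed
  have norm: "S_neg t F \<in> vcarrier (L2 ?I) \<and> vnorm (L2 ?I) (S_neg t F) = exp (t / 2) * vnorm (L2 ?I) F"
    if F: "F \<in> vcarrier (L2 ?I)" for F
  proof -
    obtain f where f: "f \<in> square_integrable ?I" "F = L2_class ?I f"
      using F by (rule L2_carrierE)
    have SF: "S_neg t F \<in> vcarrier (L2 ?I)"
      using f by (simp add: S_neg_class L2_class_in_carrier)
    have "(vnorm (L2 ?I) (S_neg t F))\<^sup>2 = (exp (t / 2))\<^sup>2 * (\<integral>x. (cmod (pull t f x))\<^sup>2 \<partial>?I)"
      using f by (simp add: S_neg_class vnorm_L2_class norm_mult power_mult_distrib)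
    also have "(\<integral>x. (cmod (pull t f x))\<^sup>2 \<partial>?I) = (vnorm (L2 ?I) F)\<^sup>2"
      using f pull_square_integrable(2)[of "{0<..<1}" f t]
      by (simp add: phi_neg_image_unit vnorm_L2_class)
    finally have "(vnorm (L2 ?I) (S_neg t F))\<^sup>2 = (exp (t / 2) * vnorm (L2 ?I) F)\<^sup>2"
      by (simp add: power_mult_distrib)
    then show ?thesis
      using SF F by (simp add: power2_eq_iff_nonneg vnorm_L2_nonneg)
  qed
  show ?thesis
    unfolding bounded_operator_def linear_map_def
    using add scale norm by (auto intro!: exI[of _ "exp (t / 2)"])
qed

lemma surj_linear_isometry_orbit_map:
  assumes "t > 0"
  shows "surj_linear_isometry (L2 (lebesgue_on {0<..<1})) (l2_int (L2 (lebesgue_on (piece t 0)))) (orbit_map t)"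
proof -
  let ?I = "lebesgue_on {0<..<1::real}"
  let ?J = "lebesgue_on (piece t 0)"
  let ?H = "L2 ?I" and ?K = "l2_int (L2 ?J)"
  have sq: "pull (of_int n * t) f \<in> square_integrable ?J" if "f \<in> square_integrable ?I" for f n
    using that by (intro pull_piece square_integrable_piece)
  have isometry: "orbit_map t F \<in> vcarrier ?K \<and> vnorm ?K (orbit_map t F) = vnorm ?H F"
    if F: "F \<in> vcarrier ?H" for F
  proof -
    obtain f where f: "f \<in> square_integrable ?I" "F = L2_class ?I f"
      using F by (rule L2_carrierE)
    have "(vnorm (L2 ?J) (orbit_map t F n))\<^sup>2 = (\<integral>x. (cmod (pull (of_int n * t) f x))\<^sup>2 \<partial>?J)" for n
      using f sq by (simp add: orbit_map_class vnorm_L2_class)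
    then have sum: "((\<lambda>n. (vnorm (L2 ?J) (orbit_map t F n))\<^sup>2) has_sum (vnorm ?H F)\<^sup>2) UNIV"
      using has_sum_pull[OF assms f(1)] f by (simp add: vnorm_L2_class)
    have VF: "orbit_map t F \<in> vcarrier ?K"
      using f sq sum by (auto simp: l2_int_def orbit_map_class summable_on_def intro: L2_class_in_carrier)
    have "(vnorm ?K (orbit_map t F))\<^sup>2 = (vnorm ?H F)\<^sup>2"
      using infsumI[OF sum] by (simp add: vnorm_l2_int_L2[OF VF])
    then show ?thesis
      using VF F by (simp add: power2_eq_iff_nonneg vnorm_L2_nonneg vnorm_l2_int_L2_nonneg)
  qed
  have add: "orbit_map t (vadd ?H F G) = vadd ?K (orbit_map t F) (orbit_map t G)"
    if F: "F \<in> vcarrier ?H" and G: "G \<in> vcarrier ?H" for F G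
  proof -
    obtain f where "f \<in> square_integrable ?I" "F = L2_class ?I f"
      using F by (rule L2_carrierE)
    moreover obtain g where "g \<in> square_integrable ?I" "G = L2_class ?I g"
      using G by (rule L2_carrierE)
    ultimately show ?thesis
      by (intro ext, simp add: l2_int_def orbit_map_class vadd_L2_class square_integrable_add sq)
         (simp add: pull_def[abs_def] distrib_left)
  qed
  have scale: "orbit_map t (vscale ?H c F) = vscale ?K c (orbit_map t F)"
    if F: "F \<in> vcarrier ?H" for c F
  proof -
    obtain f where "f \<in> square_integrable ?I" "F = L2_class ?I f"
      using F by (rule L2_carrierE)
    then show ?thesis
      by (intro ext, simp add: l2_int_def orbit_map_class vscale_L2_class square_integrable_scale sq)
         (simp add: pull_def[abs_def] mult.left_commute)
  qed
  have surj: "\<exists>F\<in>vcarrier ?H. orbit_map t F = G" if "G \<in> vcarrier ?K" for G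
  proof -
    have "\<forall>n. \<exists>g. g \<in> square_integrable ?J \<and> G n = L2_class ?J g"
    proof
      fix n
      have "G n \<in> vcarrier (L2 ?J)"
        using that by (simp add: l2_int_def)
      then show "\<exists>g. g \<in> square_integrable ?J \<and> G n = L2_class ?J g"
        by (rule L2_carrierE) blast
    qed
    then obtain g where g: "g n \<in> square_integrable ?J" "G n = L2_class ?J (g n)" for n
      by metis
    have "(\<lambda>n. \<integral>x. (cmod (g n x))\<^sup>2 \<partial>?J) summable_on UNIV"
      using that g by (simp add: l2_int_def vnorm_L2_class)
    from exists_square_integrable_with_pulls[OF assms g(1) this] obtain f where f: "f \<in> square_integrable ?I"
        "\<And>n. L2_class ?J (pull (of_int n * t) f) = L2_class ?J (g n)"
      by blast
    then have "orbit_map t (L2_class ?I f) = G"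
      using g(2) by (intro ext) (simp add: orbit_map_class)
    then show ?thesis
      using f(1) L2_class_in_carrier by blast
  qed
  show ?thesis
    unfolding surj_linear_isometry_def linear_map_def
    using isometry add scale surj by (auto simp: image_iff) metis
qed

text \<open>
  By the cocycle identity, applying \<open>U\<close> before sampling \<open>U\<^sup>n\<close> gives the sample of \<open>U\<close> to the power
  \<open>n + 1\<close>, that is, the next entry of the sequence.
\<close>

lemma orbit_map_S_neg:
  assumes "F \<in> vcarrier (L2 (lebesgue_on {0<..<1}))"
  shows "orbit_map t (S_neg t F) =
    vscale (l2_int (L2 (lebesgue_on (piece t 0)))) (of_real (exp (t / 2))) (backward_shift (orbit_map t F))"
proof
  fix n
  let ?I = "lebesgue_on {0<..<1::real}"
  let ?J = "lebesgue_on (piece t 0)"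
  let ?e = "complex_of_real (exp (t / 2))"
  obtain f where f: "f \<in> square_integrable ?I" "F = L2_class ?I f"
    using assms by (rule L2_carrierE)
  have "orbit_map t (S_neg t F) n = L2_class ?J (pull (of_int n * t) (\<lambda>x. ?e * pull t f x))"
    using f by (simp add: S_neg_class orbit_map_class)
  also have "\<dots> = L2_class ?J (\<lambda>x. ?e * pull (of_int (n + 1) * t) f x)"
  proof (rule L2_class_cong)
    fix x assume "x \<in> space ?J"
    then have "pull (of_int n * t) (pull t f) x = pull (of_int (n + 1) * t) f x"
      using piece_subset[of t 0] by (subst pull_pull) (auto simp: distrib_right)
    then show "pull (of_int n * t) (\<lambda>x. ?e * pull t f x) x = ?e * pull (of_int (n + 1) * t) f x"
      by (simp add: pull_def mult.left_commute)
  qed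
  also have "\<dots> = vscale (L2 ?J) ?e (L2_class ?J (pull (of_int (n + 1) * t) f))"
    by (rule vscale_L2_class[symmetric], rule pull_piece(1), rule square_integrable_piece[OF f(1)])
  also have "\<dots> = vscale (l2_int (L2 ?J)) ?e (backward_shift (orbit_map t F)) n"
    using f by (simp add: l2_int_def backward_shift_def orbit_map_class)
  finally show "orbit_map t (S_neg t F) n =
    vscale (l2_int (L2 ?J)) ?e (backward_shift (orbit_map t F)) n" .
qed

theorem theorem6p4:
  fixes t :: real
  assumes "t > 0"
  shows "unitarily_equivalent
           (L2 (lebesgue_on {0<..<1}))
           (S_neg t)
           (l2_int (L2 (lebesgue_on {1/2 .. 1 / (1 + exp (- t))})))
           (\<lambda>g. vscale (l2_int (L2 (lebesgue_on {1/2 .. 1 / (1 + exp (- t))})))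
                  (complex_of_real (exp (t / 2))) (backward_shift g))"
  unfolding unitarily_equivalent_def piece_0[symmetric]
  using bounded_operator_S_neg bounded_operator_scaled_shift
    surj_linear_isometry_orbit_map[OF assms] orbit_map_S_neg
  by blast

end
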